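(* A map $f:\mathbb{Z}\to\mathbb{Z}$ preserves all congruences if and only if it is an infinite sum $$f(x)=\sum_{n=0}^{\infty} a_n\cdot P_n(x)\qquad (x\in\mathbb{Z}),$$ where each $a_n$ is an integer multiple of $\mathrm{lcm}(n)$ and $P_n$ is the polynomial equal to $\binom{X+k}{2k}$ if $n=2k$ and equal to $\binom{X+k}{2k+1}$ if $n=2k+1$.
   Context: For a non-negative integer $r$, write $x\equiv_r y$ for $x,y\in\mathbb{Z}$ if $x-y$ is a multiple of $r$ (so $\equiv_0$ is equality). The congruences on $\mathbb{Z}$ are the relations $\equiv_r$, $r\in\mathbb{N}$ (where $0\in\mathbb N$). A map $f$ preserves $\equiv_r$ if $x\equiv_r y$ implies $f(x)\equiv_r f(y)$ for all $x,y\in\mathbb{Z}$; it preserves all congruences if it preserves $\equiv_r$ for every $r\in\mathbb{N}$. $\mathrm{lcm}(0):=1$ and $\mathrm{lcm}(n):=\mathrm{lcm}\{1,\dots,n\}$ for $n\geq 1$. The binomial polynomial is $\binom{X}{n}:=\frac{X(X-1)\cdots(X-n+1)}{n!}$, with $\binom{X}{0}:=1$. For every fixed $x\in\mathbb{Z}$ one has $P_n(x)=0$ for all but finitely many $n$, so the sum has only finitely many non-zero terms at each $x$. *)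

theory Defs
  imports Complex_Main "HOL-Number_Theory.Cong" "HOL-Computational_Algebra.Polynomial"
begin

text \<open>Congruence modulo 0 is equality, as \<open>x mod 0 = x\<close>; so \<open>r\<close> ranges over all naturals including 0.\<close>

definition preserves_cong :: "nat \<Rightarrow> (int \<Rightarrow> int) \<Rightarrow> bool" where
  "preserves_cong r f \<longleftrightarrow> (\<forall>x y. [x = y] (mod int r) \<longrightarrow> [f x = f y] (mod int r))"

definition preserves_all_congs :: "(int \<Rightarrow> int) \<Rightarrow> bool" where
  "preserves_all_congs f \<longleftrightarrow> (\<forall>r. preserves_cong r f)"

definition lcm_upto :: "nat \<Rightarrow> nat" where
  "lcm_upto n = (if n = 0 then 1 else Lcm {1..n})"

text \<open>The coefficients are rational but not integral in general, so we work in \<open>real poly\<close>.\<close>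

definition binom_poly :: "nat \<Rightarrow> real poly" where
  "binom_poly n = smult (1 / fact n) (\<Prod>i<n. [:- real i, 1:])"

text \<open>Composition with \<open>[:real k, 1:]\<close> is the substitution of \<open>X + k\<close> for \<open>X\<close>.\<close>

definition P_poly :: "nat \<Rightarrow> real poly" where
  "P_poly n =
    (let k = n div 2
     in if even n then pcompose (binom_poly (2 * k)) [:real k, 1:]
        else pcompose (binom_poly (2 * k + 1)) [:real k, 1:])"

end

theory Submission
  imports Defs "HOL-Computational_Algebra.Formal_Power_Series"
begin

text \<open>
  A map \<open>f\<close> preserves all congruences iff \<open>x - y\<close> divides \<open>f x - f y\<close> for all integers
  \<open>x\<close>, \<open>y\<close>. The values of the \<open>P\<^sub>n\<close> on integers are the integers
  \<open>int_binom (x + \<lfloor>n/2\<rfloor>) n\<close>.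

  For sufficiency, Vandermonde's identity expands
  \<open>int_binom (x + d) n - int_binom x n\<close> into the sum of
  \<open>int_binom d i * int_binom x (n - i)\<close> over \<open>1 \<le> i \<le> n\<close>; since
  \<open>i * int_binom d i = d * int_binom (d - 1) (i - 1)\<close>, every multiple of all of \<open>1, \<dots>, n\<close> turns
  each summand into a multiple of \<open>d\<close> (\<open>diff_dvd_mult_int_binom_diff\<close>). So each term
  \<open>a\<^sub>n P\<^sub>n\<close> preserves all congruences, and at two given arguments the infinite sums are finite.

  For necessity, the \<open>P\<^sub>n\<close> are the Newton basis for the nodes \<open>0, -1, 1, -2, 2, \<dots>\<close>: \<open>P\<^sub>n\<close>
  vanishes at the first \<open>n\<close> nodes and equals \<open>(-1)\<^sup>n\<close> at the next one. Hence every integer map is a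
  unique such sum with integral coefficients, computed greedily. If \<open>a\<^sub>0, \<dots>, a\<^bsub>n-1\<^esub>\<close> are
  multiples of the respective \<open>lcm\<close>s, then \<open>g = f - (a\<^sub>0 P\<^sub>0 + \<dots> + a\<^bsub>n-1\<^esub> P\<^bsub>n-1\<^esub>)\<close> still preserves
  all congruences by the first half. The first \<open>n + 1\<close> nodes fill an interval with the last
  node \<open>x\<close> at one of its ends, so for \<open>1 \<le> r \<le> n\<close> one of \<open>x \<plusminus> r\<close> is an earlier node, where
  \<open>g\<close> vanishes. Therefore \<open>r\<close> divides \<open>g x = \<plusminus>a\<^sub>n\<close> (\<open>lcm_upto_dvd_next_value\<close>).
\<close>

section \<open>Congruence preservation as a divisibility condition\<close>

lemma preserves_all_congs_iff_dvd:
  "preserves_all_congs f \<longleftrightarrow> (\<forall>x y. x - y dvd f x - f y)"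
proof
  assume f: "preserves_all_congs f"
  show "\<forall>x y. x - y dvd f x - f y"
  proof (intro allI)
    fix x y :: int
    have "[x = y] (mod int (nat \<bar>x - y\<bar>))"
      by (simp add: cong_iff_dvd_diff)
    then have "[f x = f y] (mod int (nat \<bar>x - y\<bar>))"
      using f unfolding preserves_all_congs_def preserves_cong_def by blast
    then show "x - y dvd f x - f y"
      by (simp add: cong_iff_dvd_diff)
  qed
next
  assume "\<forall>x y. x - y dvd f x - f y"
  then show "preserves_all_congs f"
    unfolding preserves_all_congs_def preserves_cong_def cong_iff_dvd_diff
    by (meson dvd_trans)
qed

lemma int_lcm_upto_dvd_iff:
  "int (lcm_upto n) dvd a \<longleftrightarrow> (\<forall>r\<in>{1..n}. int r dvd a)"
proof -
  have "int (lcm_upto n) dvd a \<longleftrightarrow> lcm_upto n dvd nat \<bar>a\<bar>"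
    by (simp add: dvd_nat_abs_iff)
  also have "\<dots> \<longleftrightarrow> (\<forall>r\<in>{1..n}. r dvd nat \<bar>a\<bar>)"
    by (auto simp: lcm_upto_def Lcm_dvd_iff simp del: dvd_nat_abs_iff)
  also have "\<dots> \<longleftrightarrow> (\<forall>r\<in>{1..n}. int r dvd a)"
    by (simp add: dvd_nat_abs_iff)
  finally show ?thesis .
qed

section \<open>Multiples of binomial coefficients that preserve congruences\<close>

text \<open>
  The binomial coefficient with an arbitrary integer above, as an integer; the division is exact.
  It is the instance of \<open>gchoose\<close> at type \<^typ>\<open>int\<close> (\<open>gbinomial_eq_int_binom\<close>). A constant of
  its own is needed because the type constraint on \<open>gchoose\<close> admits only fields of
  characteristic 0 when terms are parsed.
\<close>

definition int_binom :: "int \<Rightarrow> nat \<Rightarrow> int" where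
  "int_binom x n = (\<Prod>i=0..<n. x - int i) div fact n"

lemmas gbinomial_eq_int_binom = gbinomial_prod_rev[where 'a = int, folded int_binom_def]

lemma of_int_int_binom: "real_of_int (int_binom x n) = real_of_int x gchoose n"
  by (simp add: of_int_gbinomial flip: gbinomial_eq_int_binom)

lemma int_binom_0 [simp]: "int_binom x 0 = 1"
  by (simp add: int_binom_def)

lemma int_binom_diagonal: "int_binom (int n) n = 1"
  by (simp flip: gbinomial_eq_int_binom)

lemma int_binom_minus_one: "int_binom (- 1) n = (- 1) ^ n"
  by (simp flip: gbinomial_eq_int_binom)

lemma int_binom_eq_0: "0 \<le> x \<Longrightarrow> x < int n \<Longrightarrow> int_binom x n = 0"
  by (simp add: gbinomial_nneg nat_less_iff flip: gbinomial_eq_int_binom)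

lemma int_binom_Vandermonde:
  "(\<Sum>k=0..n. int_binom a k * int_binom b (n - k)) = int_binom (a + b) n"
proof -
  have "real_of_int (\<Sum>k=0..n. int_binom a k * int_binom b (n - k)) = real_of_int (int_binom (a + b) n)"
    by (simp add: of_int_int_binom gbinomial_Vandermonde)
  then show ?thesis
    by (simp only: of_int_eq_iff)
qed

lemma int_binom_absorption:
  "int (Suc k) * int_binom a (Suc k) = a * int_binom (a - 1) k"
proof -
  have "real_of_int (int (Suc k) * int_binom a (Suc k)) = real_of_int (a * int_binom (a - 1) k)"
    using gbinomial_absorption[of k "real_of_int a"] by (simp add: of_int_int_binom)
  then show ?thesis
    by (simp only: of_int_eq_iff)
qed

lemma dvd_mult_int_binom:
  assumes "int (Suc k) dvd c"
  shows "d dvd c * int_binom d (Suc k)"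
proof -
  from assms obtain q where "c = int (Suc k) * q" ..
  then have "c * int_binom d (Suc k) = q * (int (Suc k) * int_binom d (Suc k))"
    by (simp only: ac_simps)
  also have "\<dots> = d * (q * int_binom (d - 1) k)"
    by (simp only: int_binom_absorption ac_simps)
  finally show ?thesis
    by simp
qed

lemma diff_dvd_mult_int_binom_diff:
  fixes x y c :: int
  assumes c: "\<And>r. r \<in> {1..n} \<Longrightarrow> int r dvd c"
  shows "x - y dvd c * int_binom x n - c * int_binom y n"
proof -
  have "int_binom x n = (\<Sum>k=0..n. int_binom (x - y) k * int_binom y (n - k))"
    by (simp add: int_binom_Vandermonde)
  also have "\<dots> = int_binom y n + (\<Sum>k=1..n. int_binom (x - y) k * int_binom y (n - k))"
    by (simp add: sum.atLeast_Suc_atMost)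
  finally have "c * int_binom x n - c * int_binom y n
      = (\<Sum>k=1..n. c * int_binom (x - y) k * int_binom y (n - k))"
    by (simp add: distrib_left sum_distrib_left mult.assoc)
  moreover have "x - y dvd c * int_binom (x - y) k * int_binom y (n - k)" if "k \<in> {1..n}" for k
  proof -
    from that obtain m where "k = Suc m"
      by (cases k) auto
    then show ?thesis
      using dvd_mult_int_binom[of m c "x - y"] c[OF that] by (simp add: dvd_mult2)
  qed
  ultimately show ?thesis
    by (simp only: dvd_sum)
qed

section \<open>The Newton basis and its nodes\<close>

text \<open>The value of \<open>P_poly n\<close> at an integer, as an integer.\<close>

definition newton_basis :: "nat \<Rightarrow> int \<Rightarrow> int" where
  "newton_basis n x = int_binom (x + int (n div 2)) n"

text \<open>The interpolation nodes \<open>0, -1, 1, -2, 2, \<dots>\<close>, an enumeration of the integers.\<close>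

definition node :: "nat \<Rightarrow> int" where
  "node n = (if even n then int (n div 2) else - int (n div 2) - 1)"

lemma poly_binom_poly: "poly (binom_poly n) x = x gchoose n"
  by (simp add: binom_poly_def poly_prod gbinomial_prod_rev atLeast0LessThan)

lemma poly_P_poly_of_int: "poly (P_poly n) (real_of_int x) = real_of_int (newton_basis n x)"
proof -
  have "P_poly n = pcompose (binom_poly n) [:real (n div 2), 1:]"
    by (cases "even n") (simp_all add: P_poly_def Let_def)
  then show ?thesis
    by (simp add: poly_pcompose poly_binom_poly newton_basis_def of_int_int_binom add.commute)
qed

lemma diff_dvd_newton_basis_diff:
  assumes "int (lcm_upto n) dvd c"
  shows "x - y dvd c * newton_basis n x - c * newton_basis n y"
  using diff_dvd_mult_int_binom_diff[of n c "x + int (n div 2)" "y + int (n div 2)"] assms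
  by (simp add: newton_basis_def int_lcm_upto_dvd_iff)

lemma exists_node_index: "\<exists>m. x = node m"
proof (cases "x \<ge> 0")
  case True
  then have "x = node (2 * nat x)"
    by (simp add: node_def)
  then show ?thesis ..
next
  case False
  then have "x = node (2 * nat (- x - 1) + 1)"
    by (simp add: node_def)
  then show ?thesis ..
qed

lemma newton_basis_node_less:
  assumes "m < n"
  shows "newton_basis n (node m) = 0"
proof -
  have "0 \<le> node m + int (n div 2)" and "node m + int (n div 2) < int n"
    using assms by (auto simp: node_def elim!: evenE oddE)
  then show ?thesis
    by (simp add: newton_basis_def int_binom_eq_0)
qed

lemma newton_basis_node: "newton_basis n (node n) = (- 1) ^ n"
proof (cases "even n")
  case True
  then have "node n + int (n div 2) = int n"
    by (auto simp: node_def)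
  with True show ?thesis
    by (simp add: newton_basis_def int_binom_diagonal)
next
  case False
  then have "node n + int (n div 2) = - 1"
    by (simp add: node_def)
  then show ?thesis
    by (simp only: newton_basis_def int_binom_minus_one)
qed

text \<open>
  The first \<open>n + 1\<close> nodes form an interval of integers with \<open>node n\<close> at one end: the right end
  for even \<open>n\<close>, the left one for odd \<open>n\<close>.
\<close>

lemma exists_earlier_node_at_distance:
  assumes "1 \<le> r" "r \<le> n"
  shows "\<exists>m<n. \<bar>node n - node m\<bar> = int r"
proof -
  define x where "x = (if even n then node n - int r else node n + int r)"
  obtain m where m: "x = node m"
    using exists_node_index by blast
  have "m < n"
    using assms m by (auto simp: x_def node_def split: if_splits elim!: evenE oddE)
  moreover have "\<bar>node n - node m\<bar> = int r"
    by (auto simp: x_def simp flip: m)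
  ultimately show ?thesis by blast
qed

lemma lcm_upto_dvd_next_value:
  assumes g: "\<forall>x y. x - y dvd g x - g y"
    and zero: "\<And>m. m < n \<Longrightarrow> g (node m) = 0"
  shows "int (lcm_upto n) dvd g (node n)"
  unfolding int_lcm_upto_dvd_iff
proof
  fix r assume "r \<in> {1..n}"
  then obtain m where "m < n" "\<bar>node n - node m\<bar> = int r"
    using exists_earlier_node_at_distance[of r n] by auto
  then show "int r dvd g (node n)"
    using g[rule_format, of "node n" "node m"] zero[of m] by (metis abs_dvd_iff diff_zero)
qed

lemma newton_series_sums:
  "(\<lambda>n. real_of_int (a n) * poly (P_poly n) (real_of_int (node m))) sums
     real_of_int (\<Sum>n\<le>m. a n * newton_basis n (node m))"
proof -
  have "(\<lambda>n. real_of_int (a n * newton_basis n (node m))) sums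
      (\<Sum>n\<le>m. real_of_int (a n * newton_basis n (node m)))"
    by (rule sums_finite) (auto simp: newton_basis_node_less)
  then show ?thesis
    by (simp add: poly_P_poly_of_int)
qed

section \<open>Greedy computation of the coefficients\<close>

text \<open>
  \<open>newton_residual f n\<close> is \<open>f\<close> minus the first \<open>n\<close> terms of its Newton series. The factor
  \<open>(- 1) ^ n\<close> is the inverse of \<open>newton_basis n (node n)\<close>.
\<close>

primrec newton_residual :: "(int \<Rightarrow> int) \<Rightarrow> nat \<Rightarrow> int \<Rightarrow> int" where
  "newton_residual f 0 = f"
| "newton_residual f (Suc n) = (\<lambda>x. newton_residual f n x
     - (- 1) ^ n * newton_residual f n (node n) * newton_basis n x)"

text \<open>The coefficient \<open>a\<^sub>n\<close> of the Newton series of \<open>f\<close>.\<close>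

definition newton_coeff :: "(int \<Rightarrow> int) \<Rightarrow> nat \<Rightarrow> int" where
  "newton_coeff f n = (- 1) ^ n * newton_residual f n (node n)"

lemma newton_residual_expansion:
  "f x = (\<Sum>i<n. newton_coeff f i * newton_basis i x) + newton_residual f n x"
  by (induction n) (simp_all add: newton_coeff_def)

lemma newton_residual_node_less: "m < n \<Longrightarrow> newton_residual f n (node m) = 0"
proof (induction n)
  case (Suc n)
  show ?case
  proof (cases "m = n")
    case True
    have "(- 1 :: int) ^ n * (- 1) ^ n = 1"
      by (simp flip: power_mult_distrib)
    with True show ?thesis
      by (simp add: newton_basis_node mult.commute mult.left_commute)
  next
    case False
    with Suc show ?thesis
      by (simp add: newton_basis_node_less)
  qed
qed simp

text \<open>
  The coefficient subtracted at step \<open>n\<close> is a multiple of \<open>lcm_upto n\<close> because the residual of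
  step \<open>n\<close> preserves all congruences; that in turn makes the subtracted term preserve them.
\<close>

lemma diff_dvd_newton_residual_diff:
  assumes f: "\<forall>x y. x - y dvd f x - f y"
  shows "\<forall>x y. x - y dvd newton_residual f n x - newton_residual f n y"
proof (induction n)
  case 0
  show ?case using f by simp
next
  case (Suc n)
  show ?case
  proof (intro allI)
    fix x y :: int
    have "int (lcm_upto n) dvd newton_coeff f n"
      unfolding newton_coeff_def
      by (intro dvd_mult lcm_upto_dvd_next_value Suc.IH newton_residual_node_less)
    then have "x - y dvd (newton_residual f n x - newton_residual f n y)
        - (newton_coeff f n * newton_basis n x - newton_coeff f n * newton_basis n y)"
      by (intro dvd_diff[OF Suc.IH[rule_format] diff_dvd_newton_basis_diff])
    then show "x - y dvd newton_residual f (Suc n) x - newton_residual f (Suc n) y"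
      by (simp add: newton_coeff_def algebra_simps)
  qed
qed

lemma lcm_upto_dvd_newton_coeff:
  assumes "\<forall>x y. x - y dvd f x - f y"
  shows "int (lcm_upto n) dvd newton_coeff f n"
  unfolding newton_coeff_def
  by (intro dvd_mult lcm_upto_dvd_next_value diff_dvd_newton_residual_diff[OF assms]
      newton_residual_node_less)

section \<open>The characterisation\<close>

theorem theorem2p1:
  fixes f :: "int \<Rightarrow> int"
  shows "preserves_all_congs f \<longleftrightarrow>
    (\<exists>a :: nat \<Rightarrow> int.
       (\<forall>n. int (lcm_upto n) dvd a n) \<and>
       (\<forall>x :: int. (\<lambda>n. real_of_int (a n) * poly (P_poly n) (real_of_int x)) sums real_of_int (f x)))"
proof
  assume "preserves_all_congs f"
  then have f: "\<forall>x y. x - y dvd f x - f y"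
    by (simp add: preserves_all_congs_iff_dvd)
  have "(\<lambda>n. real_of_int (newton_coeff f n) * poly (P_poly n) (real_of_int x))
      sums real_of_int (f x)" for x
  proof -
    obtain m where x: "x = node m"
      using exists_node_index by blast
    have "f x = (\<Sum>n\<le>m. newton_coeff f n * newton_basis n x)"
      using newton_residual_expansion[of f x "Suc m"] newton_residual_node_less[of m "Suc m" f]
      by (simp only: x lessThan_Suc_atMost lessI add_0_right)
    then show ?thesis
      using newton_series_sums[of "newton_coeff f" m] by (simp only: x)
  qed
  then show "\<exists>a. (\<forall>n. int (lcm_upto n) dvd a n) \<and>
      (\<forall>x. (\<lambda>n. real_of_int (a n) * poly (P_poly n) (real_of_int x)) sums real_of_int (f x))"
    using lcm_upto_dvd_newton_coeff[OF f] by blast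
next
  assume "\<exists>a. (\<forall>n. int (lcm_upto n) dvd a n) \<and>
      (\<forall>x. (\<lambda>n. real_of_int (a n) * poly (P_poly n) (real_of_int x)) sums real_of_int (f x))"
  then obtain a where a: "\<And>n. int (lcm_upto n) dvd a n"
    and sums: "\<And>x. (\<lambda>n. real_of_int (a n) * poly (P_poly n) (real_of_int x)) sums real_of_int (f x)"
    by blast
  \<comment> \<open>Any bound beyond the index of the node gives the same value, so two nodes can share one.\<close>
  have partial: "f (node m) = (\<Sum>n\<le>M. a n * newton_basis n (node m))" if "m \<le> M" for m M
  proof -
    have "f (node m) = (\<Sum>n\<le>m. a n * newton_basis n (node m))"
      using sums_unique2[OF sums newton_series_sums] by (simp only: of_int_eq_iff)
    also have "\<dots> = (\<Sum>n\<le>M. a n * newton_basis n (node m))"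
      using that by (intro sum.mono_neutral_left) (auto simp: newton_basis_node_less)
    finally show ?thesis .
  qed
  have "x - y dvd f x - f y" for x y
  proof -
    obtain k l where xy: "x = node k" "y = node l"
      using exists_node_index by metis
    have "f x - f y = (\<Sum>n\<le>max k l. a n * newton_basis n x - a n * newton_basis n y)"
      using partial[of k "max k l"] partial[of l "max k l"] by (simp add: xy sum_subtractf)
    then show ?thesis
      by (simp only: dvd_sum diff_dvd_newton_basis_diff a)
  qed
  then show "preserves_all_congs f"
    by (simp add: preserves_all_congs_iff_dvd)
qed

end
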